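(* Let $\mathcal{M}_m$ be a meridian surface in $\mathbb{E}^4_2$ parametrized by $$z(u,v) = f(u)\left(\varphi(v)\cosh v\, e_1 + \varphi(v)\sinh v\, e_3 + \frac{\varphi^2(v)}{2}\,\xi_1 + \xi_2\right) + g(u)\,\xi_1,\quad u\in I,\ v\in J,$$ with the normalization $2\varepsilon f'g'=1$ on $I$. Then $\mathcal{M}_m$ has non-zero parallel mean curvature vector field (i.e. $H\neq0$ and $DH=0$) if and only if the curvature $\kappa$ of the curve $c$ is identically zero and the meridian curve $m$ is determined by $f'=\phi(f)$, where $$\phi(t)=\frac{a\,t^2+b}{2t},\qquad a=\mathrm{const}\neq0,\quad b=\mathrm{const},$$ and $g(u)$ is defined by $g'(u)=\frac{\varepsilon}{2f'(u)}$. In this case $\mathcal{M}_m$ is a non-flat CMC surface lying in a hyperplane of $\mathbb{E}^4_2$.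
   Context: $\mathbb{E}^4_2$ is $\mathbb{R}^4$ with the metric $\langle\cdot,\cdot\rangle$ given by $dx_1^2+dx_2^2-dx_3^2-dx_4^2$, and $e_1,e_2,e_3,e_4$ is a fixed orthonormal basis with $\langle e_1,e_1\rangle=\langle e_2,e_2\rangle=1$, $\langle e_3,e_3\rangle=\langle e_4,e_4\rangle=-1$. Put $\xi_1=\frac{e_2+e_4}{\sqrt2}$, $\xi_2=\frac{-e_2+e_4}{\sqrt2}$, so that $\langle\xi_1,\xi_1\rangle=\langle\xi_2,\xi_2\rangle=0$, $\langle\xi_1,\xi_2\rangle=-1$. Let $I,J\subset\mathbb{R}$ be open intervals, $f,g:I\to\mathbb{R}$ and $\varphi:J\to\mathbb{R}$ smooth with $f>0$. Primes denote derivatives with respect to $u$ and dots denote derivatives of $\varphi$ with respect to $v$. The surface $\mathcal{M}_m$ given by $z(u,v)$ is called a meridian surface; its first fundamental form has coefficients $E=-2f'g'$, $F=0$, $G=f^2(\dot\varphi^2-\varphi^2)$. Only Lorentz surfaces (induced metric of signature $(1,1)$) are considered, so it is assumed that either $\dot\varphi^2-\varphi^2>0$ on $J$ and $f'g'>0$ on $I$ (then put $\varepsilon=1$), or $\dot\varphi^2-\varphi^2<0$ on $J$ and $f'g'<0$ on $I$ (then put $\varepsilon=-1$). The parameter $u$ is normalized so that $2\varepsilon f'g'=1$. The meridian curve $m$ is the curve determined by the functions $f(u),g(u)$; the $u$-lines $v=\mathrm{const}$ of $\mathcal{M}_m$ are its (mutually congruent) copies. The curve $c$ is $l(v)=\varphi(v)\cosh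 v\,e_1+\varphi(v)\sinh v\,e_3+\frac{\varphi^2(v)}{2}\xi_1+\xi_2$, $v\in J$, and its curvature is $$\kappa(v)=\frac{\varphi\ddot\varphi-2\dot\varphi^2+\varphi^2}{\left(\varepsilon(\dot\varphi^2-\varphi^2)\right)^{3/2}}.$$ The mean curvature vector field is $H=\frac12\,\mathrm{tr}\,h$, where $h$ is the second fundamental form and the trace is taken with respect to the induced metric. The normal connection $D$ is given by $D_X\xi=$ the normal part of $\overline\nabla_X\xi$ for tangent $X$ and normal $\xi$, where $\overline\nabla$ is the flat connection of $\mathbb{E}^4_2$. $H$ is parallel if $DH=0$ identically. A CMC surface is one with $\langle H,H\rangle=\mathrm{const}\neq0$. A surface is flat if its Gauss curvature vanishes identically, and non-flat otherwise. A hyperplane is a 3-dimensional affine subspace. *)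

theory Defs
  imports "HOL-Analysis.Analysis"
begin

text \<open>Intended for open \<open>S\<close> only, where \<open>deriv\<close> does not depend on values outside \<open>S\<close>.\<close>

definition smooth_on_open :: "real set \<Rightarrow> (real \<Rightarrow> real) \<Rightarrow> bool" where
  "smooth_on_open S f \<longleftrightarrow> (\<forall>n. \<forall>x\<in>S. (deriv ^^ n) f differentiable (at x))"

definition pinner :: "real^4 \<Rightarrow> real^4 \<Rightarrow> real" where
  "pinner x y = x$1 * y$1 + x$2 * y$2 - x$3 * y$3 - x$4 * y$4"

definition pseudo_orthonormal :: "(4 \<Rightarrow> real^4) \<Rightarrow> bool" where
  "pseudo_orthonormal e \<longleftrightarrow>
     (\<forall>i j. pinner (e i) (e j) = (if i = j then (if i = 1 \<or> i = 2 then 1 else -1) else 0))"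

definition xi1 :: "(4 \<Rightarrow> real^4) \<Rightarrow> real^4" where
  "xi1 e = (1 / sqrt 2) *\<^sub>R (e 2 + e 4)"

definition xi2 :: "(4 \<Rightarrow> real^4) \<Rightarrow> real^4" where
  "xi2 e = (1 / sqrt 2) *\<^sub>R (- e 2 + e 4)"

text \<open>A surface is a map of two real parameters; the indices \<open>1, 2\<close> of type \<open>2\<close> refer to the
  parameters \<open>u, v\<close>. The parameters range over open sets, so that the values of a map outside
  its parameter domain do not influence its derivatives there. All notions below are meaningful
  at points where the induced metric is nondegenerate.\<close>

definition pd :: "2 \<Rightarrow> (real \<Rightarrow> real \<Rightarrow> 'a::real_normed_vector) \<Rightarrow> real \<Rightarrow> real \<Rightarrow> 'a" where
  "pd i w u v = (if i = 1 then vector_derivative (\<lambda>s. w s v) (at u)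
                 else vector_derivative (\<lambda>t. w u t) (at v))"

definition tangent_space :: "(real \<Rightarrow> real \<Rightarrow> real^4) \<Rightarrow> real \<Rightarrow> real \<Rightarrow> (real^4) set" where
  "tangent_space z u v = span {pd 1 z u v, pd 2 z u v}"

definition normal_space :: "(real \<Rightarrow> real \<Rightarrow> real^4) \<Rightarrow> real \<Rightarrow> real \<Rightarrow> (real^4) set" where
  "normal_space z u v = {n. \<forall>x\<in>tangent_space z u v. pinner n x = 0}"

definition normal_part :: "(real \<Rightarrow> real \<Rightarrow> real^4) \<Rightarrow> real \<Rightarrow> real \<Rightarrow> real^4 \<Rightarrow> real^4" where
  "normal_part z u v w = (THE n. n \<in> normal_space z u v \<and> w - n \<in> tangent_space z u v)"

definition induced_metric :: "(real \<Rightarrow> real \<Rightarrow> real^4) \<Rightarrow> real \<Rightarrow> real \<Rightarrow> real^2^2" where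
  "induced_metric z u v = (\<chi> i j. pinner (pd i z u v) (pd j z u v))"

definition second_ff :: "(real \<Rightarrow> real \<Rightarrow> real^4) \<Rightarrow> 2 \<Rightarrow> 2 \<Rightarrow> real \<Rightarrow> real \<Rightarrow> real^4" where
  "second_ff z i j u v = normal_part z u v (pd i (pd j z) u v)"

definition mean_curvature :: "(real \<Rightarrow> real \<Rightarrow> real^4) \<Rightarrow> real \<Rightarrow> real \<Rightarrow> real^4" where
  "mean_curvature z u v =
     (1/2) *\<^sub>R (\<Sum>i\<in>UNIV. \<Sum>j\<in>UNIV. (matrix_inv (induced_metric z u v) $ i $ j) *\<^sub>R second_ff z i j u v)"

text \<open>\<open>D\<^sub>X \<xi>\<close> for the tangent vector \<open>X\<close> with components \<open>X $ i\<close> in the coordinate frame and a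
  normal field \<open>\<xi>\<close>; the flat connection is componentwise directional differentiation.\<close>

definition normal_connection ::
  "(real \<Rightarrow> real \<Rightarrow> real^4) \<Rightarrow> real^2 \<Rightarrow> (real \<Rightarrow> real \<Rightarrow> real^4) \<Rightarrow> real \<Rightarrow> real \<Rightarrow> real^4" where
  "normal_connection z X \<xi> u v = normal_part z u v (\<Sum>i\<in>UNIV. X $ i *\<^sub>R pd i \<xi> u v)"

definition parallel_on ::
  "real set \<Rightarrow> real set \<Rightarrow> (real \<Rightarrow> real \<Rightarrow> real^4) \<Rightarrow> (real \<Rightarrow> real \<Rightarrow> real^4) \<Rightarrow> bool" where
  "parallel_on I J z \<xi> \<longleftrightarrow> (\<forall>u\<in>I. \<forall>v\<in>J. \<forall>X. normal_connection z X \<xi> u v = 0)"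

text \<open>The Gauss curvature is intrinsic: it is the sectional curvature of the Levi-Civita
  connection of the induced metric. Here \<open>christoffel z k i j\<close> is \<open>\<Gamma>\<close> with upper index \<open>k\<close>,
  and \<open>riemann z l k i j\<close> is the \<open>l\<close>-th component of \<open>R(\<partial>\<^sub>i, \<partial>\<^sub>j) \<partial>\<^sub>k\<close>.\<close>

definition christoffel :: "(real \<Rightarrow> real \<Rightarrow> real^4) \<Rightarrow> 2 \<Rightarrow> 2 \<Rightarrow> 2 \<Rightarrow> real \<Rightarrow> real \<Rightarrow> real" where
  "christoffel z k i j u v =
     (1/2) * (\<Sum>l\<in>UNIV. matrix_inv (induced_metric z u v) $ k $ l *
       (pd i (\<lambda>u v. induced_metric z u v $ j $ l) u v
        + pd j (\<lambda>u v. induced_metric z u v $ i $ l) u v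
        - pd l (\<lambda>u v. induced_metric z u v $ i $ j) u v))"

definition riemann :: "(real \<Rightarrow> real \<Rightarrow> real^4) \<Rightarrow> 2 \<Rightarrow> 2 \<Rightarrow> 2 \<Rightarrow> 2 \<Rightarrow> real \<Rightarrow> real \<Rightarrow> real" where
  "riemann z l k i j u v =
     pd i (christoffel z l j k) u v - pd j (christoffel z l i k) u v
     + (\<Sum>m\<in>UNIV. christoffel z l i m u v * christoffel z m j k u v
                  - christoffel z l j m u v * christoffel z m i k u v)"

definition gauss_curvature :: "(real \<Rightarrow> real \<Rightarrow> real^4) \<Rightarrow> real \<Rightarrow> real \<Rightarrow> real" where
  "gauss_curvature z u v =
     (\<Sum>l\<in>UNIV. induced_metric z u v $ 1 $ l * riemann z l 2 1 2 u v) / det (induced_metric z u v)"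

definition flat_on :: "real set \<Rightarrow> real set \<Rightarrow> (real \<Rightarrow> real \<Rightarrow> real^4) \<Rightarrow> bool" where
  "flat_on I J z \<longleftrightarrow> (\<forall>u\<in>I. \<forall>v\<in>J. gauss_curvature z u v = 0)"

definition CMC_on :: "real set \<Rightarrow> real set \<Rightarrow> (real \<Rightarrow> real \<Rightarrow> real^4) \<Rightarrow> bool" where
  "CMC_on I J z \<longleftrightarrow>
     (\<exists>c. c \<noteq> 0 \<and> (\<forall>u\<in>I. \<forall>v\<in>J. pinner (mean_curvature z u v) (mean_curvature z u v) = c))"

definition in_hyperplane_on :: "real set \<Rightarrow> real set \<Rightarrow> (real \<Rightarrow> real \<Rightarrow> real^4) \<Rightarrow> bool" where
  "in_hyperplane_on I J z \<longleftrightarrow>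
     (\<exists>P. affine P \<and> aff_dim P = 3 \<and> (\<forall>u\<in>I. \<forall>v\<in>J. z u v \<in> P))"

definition curve_c :: "(4 \<Rightarrow> real^4) \<Rightarrow> (real \<Rightarrow> real) \<Rightarrow> real \<Rightarrow> real^4" where
  "curve_c e \<phi> v = (\<phi> v * cosh v) *\<^sub>R e 1 + (\<phi> v * sinh v) *\<^sub>R e 3
                   + ((\<phi> v)\<^sup>2 / 2) *\<^sub>R xi1 e + xi2 e"

definition meridian_surface ::
  "(4 \<Rightarrow> real^4) \<Rightarrow> (real \<Rightarrow> real) \<Rightarrow> (real \<Rightarrow> real) \<Rightarrow> (real \<Rightarrow> real) \<Rightarrow> real \<Rightarrow> real \<Rightarrow> real^4" where
  "meridian_surface e \<phi> f g u v = f u *\<^sub>R curve_c e \<phi> v + g u *\<^sub>R xi1 e"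

text \<open>The curvature of the curve \<open>curve_c e \<phi>\<close>, where \<open>\<epsilon> = \<plusminus>1\<close> is the sign of \<open>\<phi>'\<^sup>2 - \<phi>\<^sup>2\<close>,
  i.e. the causal character of the curve.\<close>

definition kappa :: "real \<Rightarrow> (real \<Rightarrow> real) \<Rightarrow> real \<Rightarrow> real" where
  "kappa \<epsilon> \<phi> v =
     (\<phi> v * deriv (deriv \<phi>) v - 2 * (deriv \<phi> v)\<^sup>2 + (\<phi> v)\<^sup>2)
       / (\<epsilon> * ((deriv \<phi> v)\<^sup>2 - (\<phi> v)\<^sup>2)) powr (3/2)"

end

theory Submission
  imports Defs
begin

text \<open>Write \<open>W = \<phi>'\<^sup>2 - \<phi>\<^sup>2\<close> and let \<open>K\<close> be the numerator of the curvature \<open>\<kappa>\<close>. The curve \<open>l\<close>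
  runs in the light cone, \<open>\<xi>\<^sub>1\<close> is a second null direction with \<open>\<langle>l, \<xi>\<^sub>1\<rangle> = -1\<close>, and the plane
  orthogonal to both is spanned by \<open>l'\<close> and an explicit vector \<open>\<nu>\<close> with
  \<open>\<langle>l', l'\<rangle> = W = -\<langle>\<nu>, \<nu>\<rangle>\<close>. The derivatives of this frame involve only \<open>W\<close>, \<open>W'\<close> and \<open>K\<close>
  (\<open>deriv_l1\<close>, \<open>deriv_nu\<close>).

  The tangent plane of the surface is spanned by \<open>f' l + g' \<xi>\<^sub>1\<close> and \<open>l'\<close>, hence the normal plane
  by \<open>N = f' l - g' \<xi>\<^sub>1\<close> and \<open>\<nu>\<close>. The metric is diagonal and the frame formulas give
  \<open>H = P N + Q \<nu>\<close> with \<open>P = -\<epsilon>/2 (f''/f' + f'/f)\<close> and \<open>Q = -K / (2 f W\<^sup>2)\<close>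
  (\<open>mean_curvature_eq\<close>). The derivatives of \<open>N\<close> are tangent, and \<open>\<nu>\<close> does not depend on \<open>u\<close>,
  so the normal part of \<open>\<partial>H/\<partial>u\<close> is \<open>P' N - (f'/f) Q \<nu>\<close>. As \<open>f'\<close> has no zero, a parallel \<open>H\<close> has
  \<open>Q = 0\<close> and \<open>P\<close> constant. Conversely \<open>Q = 0\<close> and a constant \<open>P\<close> leave \<open>H\<close> a constant
  multiple of \<open>N\<close>, which is parallel in the \<open>v\<close> direction as well (\<open>nonzero_parallel_iff\<close>).
  Finally \<open>P = -\<epsilon>a/2\<close> says \<open>(2 f f')' = a (f\<^sup>2)'\<close>, which integrates to
  \<open>2 f f' = a f\<^sup>2 + b\<close> (\<open>P_const_iff_meridian\<close>).

  For the consequences: \<open>\<langle>H, H\<rangle> = \<epsilon> P\<^sup>2\<close> is a non-zero constant. The Gauss curvature is \<open>\<epsilon> f''/f\<close>;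
  if \<open>f'' = 0\<close>, then a non-zero constant \<open>P\<close> makes \<open>f'\<close> a multiple of \<open>f\<close>, and differentiating once more
  gives \<open>f' = 0\<close>, which is excluded. When \<open>K = 0\<close>, the direction of \<open>\<nu>\<close> is constant, and the surface
  is orthogonal to it.\<close>

section \<open>The scalar product and normal parts\<close>

lemma pinner_commute: "pinner x y = pinner y x"
  by (simp add: pinner_def algebra_simps)

lemma pinner_linear [simp]:
  "pinner (x + y) w = pinner x w + pinner y w"
  "pinner (x - y) w = pinner x w - pinner y w"
  "pinner (c *\<^sub>R x) w = c * pinner x w"
  "pinner (- x) w = - pinner x w"
  "pinner 0 w = 0"
  "pinner w (x + y) = pinner w x + pinner w y"
  "pinner w (x - y) = pinner w x - pinner w y"
  "pinner w (c *\<^sub>R x) = c * pinner w x"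
  "pinner w (- x) = - pinner w x"
  "pinner w 0 = 0"
  by (simp_all add: pinner_def algebra_simps)

lemma tangent_space_iff:
  "x \<in> tangent_space z u v \<longleftrightarrow> (\<exists>a b. x = a *\<^sub>R pd 1 z u v + b *\<^sub>R pd 2 z u v)"
proof -
  have "x \<in> tangent_space z u v \<longleftrightarrow> (\<exists>a b. x - a *\<^sub>R pd 1 z u v - b *\<^sub>R pd 2 z u v = 0)"
    by (auto simp: tangent_space_def span_breakdown_eq)
  also have "\<dots> \<longleftrightarrow> (\<exists>a b. x = a *\<^sub>R pd 1 z u v + b *\<^sub>R pd 2 z u v)"
    by (auto simp: algebra_simps)
  finally show ?thesis .
qed

lemma normal_space_iff:
  "n \<in> normal_space z u v \<longleftrightarrow> pinner n (pd 1 z u v) = 0 \<and> pinner n (pd 2 z u v) = 0"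
proof
  assume n: "n \<in> normal_space z u v"
  have "pd 1 z u v \<in> tangent_space z u v" "pd 2 z u v \<in> tangent_space z u v"
    by (auto simp: tangent_space_def span_base)
  then show "pinner n (pd 1 z u v) = 0 \<and> pinner n (pd 2 z u v) = 0"
    using n by (auto simp: normal_space_def)
qed (auto simp: normal_space_def tangent_space_iff)

text \<open>With orthogonal non-null coordinate vectors, a vector that is both tangent and normal is
  zero, so a decomposition into a normal and a tangent part is the only one.\<close>

lemma normal_part_eqI:
  assumes F: "pinner (pd 1 z u v) (pd 2 z u v) = 0"
    and E: "pinner (pd 1 z u v) (pd 1 z u v) \<noteq> 0"
    and G: "pinner (pd 2 z u v) (pd 2 z u v) \<noteq> 0"
    and n: "pinner n (pd 1 z u v) = 0" "pinner n (pd 2 z u v) = 0"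
    and w: "w = n + a *\<^sub>R pd 1 z u v + b *\<^sub>R pd 2 z u v"
  shows "normal_part z u v w = n"
  unfolding normal_part_def
proof (rule the_equality)
  have "w - n = a *\<^sub>R pd 1 z u v + b *\<^sub>R pd 2 z u v"
    using w by simp
  then show "n \<in> normal_space z u v \<and> w - n \<in> tangent_space z u v"
    using n unfolding normal_space_iff tangent_space_iff by blast
next
  fix n' assume "n' \<in> normal_space z u v \<and> w - n' \<in> tangent_space z u v"
  then obtain c d where n': "pinner n' (pd 1 z u v) = 0" "pinner n' (pd 2 z u v) = 0"
    and wn': "w - n' = c *\<^sub>R pd 1 z u v + d *\<^sub>R pd 2 z u v"
    unfolding normal_space_iff tangent_space_iff by blast
  have eq: "n' = n + (a - c) *\<^sub>R pd 1 z u v + (b - d) *\<^sub>R pd 2 z u v"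
    using w wn' by (simp add: algebra_simps)
  have "(a - c) * pinner (pd 1 z u v) (pd 1 z u v) = 0"
    using n'(1) n F eq by (simp add: pinner_commute[of "pd 2 z u v"])
  moreover have "(b - d) * pinner (pd 2 z u v) (pd 2 z u v) = 0"
    using n'(2) n F eq by simp
  ultimately show "n' = n"
    using E G eq by simp
qed

text \<open>Affine hyperplanes for the indefinite product are Euclidean ones: flip the signs of the
  last two components of the normal vector.\<close>

lemma in_hyperplane_onI:
  assumes "n \<noteq> 0" and "\<And>u v. u \<in> I \<Longrightarrow> v \<in> J \<Longrightarrow> pinner (z u v) n = 0"
  shows "in_hyperplane_on I J z"
proof -
  define m :: "real^4" where "m = (\<chi> i. if i = 1 \<or> i = 2 then n $ i else - (n $ i))"
  have m: "m \<bullet> x = pinner x n" for x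
    by (simp add: m_def pinner_def inner_vec_def sum_4)
  have "m \<noteq> 0"
  proof
    assume "m = 0"
    then have "m $ i = 0" for i
      by simp
    then have "n $ i = 0" for i
      unfolding m_def vec_lambda_beta by (metis neg_equal_0_iff_equal)
    then show False
      using \<open>n \<noteq> 0\<close> by (simp add: vec_eq_iff)
  qed
  then have "affine {x. m \<bullet> x = 0} \<and> aff_dim {x. m \<bullet> x = 0} = 3"
    by (simp add: affine_hyperplane)
  then show ?thesis
    unfolding in_hyperplane_on_def using assms(2) m by fastforce
qed

section \<open>Calculus\<close>

lemma matrix_inv_diagonal_2:
  fixes A :: "real^2^2"
  assumes "A$1$2 = 0" "A$2$1 = 0" "A$1$1 \<noteq> 0" "A$2$2 \<noteq> 0"
  shows "matrix_inv A = (\<chi> i j. if i = j then 1 / A$i$i else 0)"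
proof -
  let ?B = "(\<chi> i j. if i = j then 1 / A$i$i else 0) :: real^2^2"
  have AB: "A ** ?B = mat 1" and BA: "?B ** A = mat 1"
    using assms by (simp_all add: matrix_matrix_mult_def mat_def vec_eq_iff sum_2 forall_2)
  have "C = ?B" if "A ** C = mat 1" for C
  proof -
    have "C = (?B ** A) ** C"
      unfolding BA by (rule matrix_mul_lid[symmetric])
    also have "\<dots> = ?B"
      unfolding matrix_mul_assoc[symmetric] that by (rule matrix_mul_rid)
    finally show ?thesis .
  qed
  then show ?thesis
    unfolding matrix_inv_def using AB BA by (blast intro: some_equality)
qed

lemma pd_1_eqI:
  assumes "open S" "u \<in> S" "\<And>s. s \<in> S \<Longrightarrow> w s v = h s"
    and "(h has_vector_derivative d) (at u)"
  shows "pd 1 w u v = d"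
  using has_vector_derivative_transform_within_open[OF assms(4,1,2), of "\<lambda>s. w s v"] assms(3)
  by (auto simp: pd_def intro!: vector_derivative_at)

lemma pd_2_eqI:
  assumes "open S" "v \<in> S" "\<And>t. t \<in> S \<Longrightarrow> w u t = h t"
    and "(h has_vector_derivative d) (at v)"
  shows "pd 2 w u v = d"
  using has_vector_derivative_transform_within_open[OF assms(4,1,2), of "\<lambda>t. w u t"] assms(3)
  by (auto simp: pd_def intro!: vector_derivative_at)

lemma vector_derivative_zero_on_interval:
  fixes h :: "real \<Rightarrow> 'a::real_normed_vector"
  assumes "open S" "is_interval S"
    and "\<And>x. x \<in> S \<Longrightarrow> (h has_vector_derivative 0) (at x)"
    and "x \<in> S" "y \<in> S"
  shows "h x = h y"
  using has_derivative_zero_unique_connected[OF assms(1), of h x y] assms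
  by (simp add: is_interval_connected has_vector_derivative_def)

lemma smooth_on_open_DERIV:
  assumes "smooth_on_open S h" "x \<in> S"
  shows "(h has_field_derivative deriv h x) (at x)"
    and "(deriv h has_field_derivative deriv (deriv h) x) (at x)"
    and "(deriv (deriv h) has_field_derivative deriv (deriv (deriv h)) x) (at x)"
proof -
  have d: "(deriv ^^ n) h differentiable (at x)" for n
    using assms by (auto simp: smooth_on_open_def)
  show "(h has_field_derivative deriv h x) (at x)"
    using d[of 0] by (simp add: DERIV_deriv_iff_real_differentiable)
  show "(deriv h has_field_derivative deriv (deriv h) x) (at x)"
    using d[of 1] by (simp add: DERIV_deriv_iff_real_differentiable)
  show "(deriv (deriv h) has_field_derivative deriv (deriv (deriv h)) x) (at x)"
    using d[of 2] by (simp add: DERIV_deriv_iff_real_differentiable numeral_2_eq_2)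
qed

lemma has_vector_derivative_real:
  "(h has_field_derivative d) (at x) \<Longrightarrow> (h has_vector_derivative d) (at (x::real))"
  by (simp add: has_real_derivative_iff_has_vector_derivative)

lemma cosh_mult_cosh:
  fixes t :: real
  shows "cosh t * cosh t = sinh t * sinh t + 1"
    and "cosh t * (cosh t * x) = sinh t * (sinh t * x) + x"
proof -
  show c: "cosh t * cosh t = sinh t * sinh t + 1"
    using cosh_square_eq[of t] by (simp add: power2_eq_square)
  then show "cosh t * (cosh t * x) = sinh t * (sinh t * x) + x"
    by (simp add: mult.assoc[symmetric] distrib_right)
qed

section \<open>A moving frame along the curve\<close>

text \<open>The two causal cases are treated together: \<open>\<epsilon>\<close> is the common sign of \<open>f' g' = \<epsilon>/2\<close> and of
  \<open>\<phi>'\<^sup>2 - \<phi>\<^sup>2\<close>.\<close>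

locale meridian =
  fixes e :: "4 \<Rightarrow> real^4"
    and I J :: "real set"
    and f g \<phi> :: "real \<Rightarrow> real"
    and \<epsilon> :: real
  assumes basis: "pseudo_orthonormal e"
    and I: "open I" "is_interval I" "I \<noteq> {}"
    and J: "open J" "is_interval J" "J \<noteq> {}"
    and smooth: "smooth_on_open I f" "smooth_on_open I g" "smooth_on_open J \<phi>"
    and f_pos: "u \<in> I \<Longrightarrow> f u > 0"
    and eps: "\<epsilon> = 1 \<or> \<epsilon> = -1"
    and causal: "v \<in> J \<Longrightarrow> \<epsilon> * ((deriv \<phi> v)\<^sup>2 - (\<phi> v)\<^sup>2) > 0"
    and normalized: "u \<in> I \<Longrightarrow> 2 * \<epsilon> * deriv f u * deriv g u = 1"
begin

abbreviation "z \<equiv> meridian_surface e \<phi> f g"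
abbreviation "f1 \<equiv> deriv f"
abbreviation "f2 \<equiv> deriv (deriv f)"
abbreviation "g1 \<equiv> deriv g"
abbreviation "\<phi>1 \<equiv> deriv \<phi>"
abbreviation "\<phi>2 \<equiv> deriv (deriv \<phi>)"

text \<open>Coordinates with respect to \<open>e\<^sub>1, e\<^sub>3, \<xi>\<^sub>1, \<xi>\<^sub>2\<close>: in these, the computations with the moving
  frame become identities between real functions.\<close>

definition frame_vec :: "real \<Rightarrow> real \<Rightarrow> real \<Rightarrow> real \<Rightarrow> real^4" where
  "frame_vec a b p q = a *\<^sub>R e 1 + b *\<^sub>R e 3 + p *\<^sub>R xi1 e + q *\<^sub>R xi2 e"

definition l :: "real \<Rightarrow> real^4" where
  "l v = frame_vec (\<phi> v * cosh v) (\<phi> v * sinh v) ((\<phi> v)\<^sup>2 / 2) 1"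

text \<open>The derivative of \<open>l\<close>.\<close>

definition l1 :: "real \<Rightarrow> real^4" where
  "l1 v = frame_vec (\<phi>1 v * cosh v + \<phi> v * sinh v) (\<phi>1 v * sinh v + \<phi> v * cosh v) (\<phi> v * \<phi>1 v) 0"

text \<open>Swapping the first two coordinates of \<open>l'\<close> gives a vector orthogonal to \<open>l'\<close> and \<open>\<xi>\<^sub>1\<close>; the
  third coordinate is then the one that makes it orthogonal to \<open>l\<close>.\<close>

definition nu :: "real \<Rightarrow> real^4" where
  "nu v = frame_vec (\<phi>1 v * sinh v + \<phi> v * cosh v) (\<phi>1 v * cosh v + \<phi> v * sinh v) ((\<phi> v)\<^sup>2) 0"

definition W :: "real \<Rightarrow> real" where
  "W v = (\<phi>1 v)\<^sup>2 - (\<phi> v)\<^sup>2"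

text \<open>The derivative of \<open>W\<close>.\<close>

definition W1 :: "real \<Rightarrow> real" where
  "W1 v = 2 * \<phi>1 v * \<phi>2 v - 2 * \<phi> v * \<phi>1 v"

definition K :: "real \<Rightarrow> real" where
  "K v = \<phi> v * \<phi>2 v - 2 * (\<phi>1 v)\<^sup>2 + (\<phi> v)\<^sup>2"

lemma W_nz: "v \<in> J \<Longrightarrow> W v \<noteq> 0"
  using causal[of v] by (auto simp: W_def)

lemma eps_sq [simp]: "\<epsilon> * \<epsilon> = 1"
  and eps_nz [simp]: "\<epsilon> \<noteq> 0"
  using eps by auto

lemma f1_nz: "u \<in> I \<Longrightarrow> f1 u \<noteq> 0"
  using normalized[of u] by auto

lemma g1_eq: "u \<in> I \<Longrightarrow> g1 u = \<epsilon> / (2 * f1 u)"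
  using normalized[of u] f1_nz[of u] eps by (auto simp: field_simps)

lemma pinner_frame_vec:
  "pinner (frame_vec a b p q) (frame_vec a' b' p' q') = a * a' - b * b' - p * q' - q * p'"
proof -
  have e: "pinner (e i) (e j) = (if i = j then if i = 1 \<or> i = 2 then 1 else -1 else 0)" for i j
    using basis by (auto simp: pseudo_orthonormal_def)
  have s: "1 / sqrt 2 * (1 / sqrt 2) = (1 / 2 :: real)"
    by simp
  have "pinner (xi1 e) (xi1 e) = 0" "pinner (xi2 e) (xi2 e) = 0"
      "pinner (xi1 e) (xi2 e) = -1" "pinner (xi2 e) (xi1 e) = -1"
      "pinner (xi1 e) (e 1) = 0" "pinner (xi1 e) (e 3) = 0"
      "pinner (e 1) (xi1 e) = 0" "pinner (e 3) (xi1 e) = 0"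
      "pinner (xi2 e) (e 1) = 0" "pinner (xi2 e) (e 3) = 0"
      "pinner (e 1) (xi2 e) = 0" "pinner (e 3) (xi2 e) = 0"
    by (simp_all add: xi1_def xi2_def e s)
  then show ?thesis
    by (simp add: frame_vec_def e algebra_simps)
qed

lemma frame_vec_linear:
  "frame_vec a b p q + frame_vec a' b' p' q' = frame_vec (a + a') (b + b') (p + p') (q + q')"
  "frame_vec a b p q - frame_vec a' b' p' q' = frame_vec (a - a') (b - b') (p - p') (q - q')"
  "c *\<^sub>R frame_vec a b p q = frame_vec (c * a) (c * b) (c * p) (c * q)"
  by (simp_all add: frame_vec_def algebra_simps)

lemma xi1_frame: "xi1 e = frame_vec 0 0 1 0"
  by (simp add: frame_vec_def)

lemma has_vector_derivative_frame_vec: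
  assumes "(a has_field_derivative a') (at t)" "(b has_field_derivative b') (at t)"
    "(p has_field_derivative p') (at t)" "(q has_field_derivative q') (at t)"
  shows "((\<lambda>t. frame_vec (a t) (b t) (p t) (q t)) has_vector_derivative frame_vec a' b' p' q') (at t)"
  unfolding frame_vec_def
  by (rule derivative_eq_intros assms refl | simp)+

lemma pinner_moving_frame [simp]:
  "pinner (l v) (l v) = 0" "pinner (xi1 e) (xi1 e) = 0"
  "pinner (l v) (xi1 e) = -1" "pinner (xi1 e) (l v) = -1"
  "pinner (l v) (l1 v) = 0" "pinner (l1 v) (l v) = 0"
  "pinner (l v) (nu v) = 0" "pinner (nu v) (l v) = 0"
  "pinner (xi1 e) (l1 v) = 0" "pinner (l1 v) (xi1 e) = 0"
  "pinner (xi1 e) (nu v) = 0" "pinner (nu v) (xi1 e) = 0"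
  "pinner (l1 v) (nu v) = 0" "pinner (nu v) (l1 v) = 0"
  "pinner (l1 v) (l1 v) = W v" "pinner (nu v) (nu v) = - W v"
  unfolding xi1_frame l_def l1_def nu_def W_def pinner_frame_vec
  by (simp_all add: algebra_simps power2_eq_square cosh_mult_cosh)

lemma nu_nz: "v \<in> J \<Longrightarrow> nu v \<noteq> 0"
  using W_nz[of v] pinner_moving_frame(16)[of v] by (metis neg_equal_0_iff_equal pinner_linear(5))

lemma DERIV_\<phi>:
  assumes "v \<in> J"
  shows "(\<phi> has_field_derivative \<phi>1 v) (at v)" "(\<phi>1 has_field_derivative \<phi>2 v) (at v)"
  using smooth_on_open_DERIV[OF smooth(3) assms] by auto

lemma DERIV_W: "v \<in> J \<Longrightarrow> (W has_field_derivative W1 v) (at v)"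
  unfolding W_def[abs_def] W1_def
  by (auto intro!: derivative_eq_intros DERIV_\<phi>)

lemma deriv_l: "v \<in> J \<Longrightarrow> (l has_vector_derivative l1 v) (at v)"
  unfolding l_def[abs_def] l1_def
  by (rule has_vector_derivative_frame_vec;
      auto intro!: derivative_eq_intros DERIV_\<phi>)

text \<open>The coefficients come from differentiating the constant products: \<open>\<langle>l'', l\<rangle> = -W\<close>,
  \<open>\<langle>l'', \<xi>\<^sub>1\<rangle> = 0\<close> and \<open>\<langle>l'', l'\<rangle> = W'/2\<close>. Only \<open>\<langle>l'', \<nu>\<rangle>\<close> is not determined in this way, and it
  equals \<open>K\<close>.\<close>

lemma deriv_l1:
  assumes v: "v \<in> J"
  shows "(l1 has_vector_derivative
    W v *\<^sub>R xi1 e + (W1 v / (2 * W v)) *\<^sub>R l1 v - (K v / W v) *\<^sub>R nu v) (at v)"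
proof -
  have eq: "x = W v * y + W1 v / (2 * W v) * s - K v / W v * t \<longleftrightarrow>
      2 * W v * x = 2 * (W v)\<^sup>2 * y + W1 v * s - 2 * K v * t" for x y s t
  proof -
    have "2 * (W v)\<^sup>2 * y + W1 v * s - 2 * K v * t
        = 2 * W v * (W v * y + W1 v / (2 * W v) * s - K v / W v * t)"
      using W_nz[OF v] by (simp add: field_simps power2_eq_square)
    then show ?thesis
      using W_nz[OF v] by simp
  qed
  have "(l1 has_vector_derivative
     frame_vec (\<phi>2 v * cosh v + 2 * \<phi>1 v * sinh v + \<phi> v * cosh v)
       (\<phi>2 v * sinh v + 2 * \<phi>1 v * cosh v + \<phi> v * sinh v) ((\<phi>1 v)\<^sup>2 + \<phi> v * \<phi>2 v) 0) (at v)"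
    unfolding l1_def[abs_def]
    by (rule has_vector_derivative_frame_vec;
        auto intro!: derivative_eq_intros DERIV_\<phi> v simp: power2_eq_square)
  also have "frame_vec (\<phi>2 v * cosh v + 2 * \<phi>1 v * sinh v + \<phi> v * cosh v)
       (\<phi>2 v * sinh v + 2 * \<phi>1 v * cosh v + \<phi> v * sinh v) ((\<phi>1 v)\<^sup>2 + \<phi> v * \<phi>2 v) 0
    = W v *\<^sub>R xi1 e + (W1 v / (2 * W v)) *\<^sub>R l1 v - (K v / W v) *\<^sub>R nu v"
    unfolding xi1_frame l1_def nu_def frame_vec_linear
    by (intro arg_cong4[where f = frame_vec] eq[THEN iffD2];
        simp add: W_def W1_def K_def algebra_simps power2_eq_square)
  finally show ?thesis .
qed

text \<open>Here \<open>\<langle>\<nu>', l\<rangle> = \<langle>\<nu>', \<xi>\<^sub>1\<rangle> = 0\<close>, \<open>\<langle>\<nu>', l'\<rangle> = -\<langle>l'', \<nu>\<rangle> = -K\<close> and \<open>\<langle>\<nu>', \<nu>\<rangle> = -W'/2\<close>. In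
  particular \<open>\<nu>'\<close> is a multiple of \<open>\<nu>\<close> exactly when the curvature vanishes.\<close>

lemma deriv_nu:
  assumes v: "v \<in> J"
  shows "(nu has_vector_derivative (W1 v / (2 * W v)) *\<^sub>R nu v - (K v / W v) *\<^sub>R l1 v) (at v)"
proof -
  have eq: "x = W1 v / (2 * W v) * s - K v / W v * t \<longleftrightarrow>
      2 * W v * x = W1 v * s - 2 * K v * t" for x s t
    using W_nz[OF v] by (simp add: field_simps)
  have "(nu has_vector_derivative
     frame_vec (\<phi>2 v * sinh v + 2 * \<phi>1 v * cosh v + \<phi> v * sinh v)
       (\<phi>2 v * cosh v + 2 * \<phi>1 v * sinh v + \<phi> v * cosh v) (2 * \<phi> v * \<phi>1 v) 0) (at v)"
    unfolding nu_def[abs_def]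
    by (rule has_vector_derivative_frame_vec;
        auto intro!: derivative_eq_intros DERIV_\<phi> v simp: power2_eq_square)
  also have "frame_vec (\<phi>2 v * sinh v + 2 * \<phi>1 v * cosh v + \<phi> v * sinh v)
       (\<phi>2 v * cosh v + 2 * \<phi>1 v * sinh v + \<phi> v * cosh v) (2 * \<phi> v * \<phi>1 v) 0
    = (W1 v / (2 * W v)) *\<^sub>R nu v - (K v / W v) *\<^sub>R l1 v"
    unfolding l1_def nu_def frame_vec_linear
    by (intro arg_cong4[where f = frame_vec] eq[THEN iffD2];
        simp add: W_def W1_def K_def algebra_simps power2_eq_square)
  finally show ?thesis .
qed

section \<open>First and second fundamental form\<close>

text \<open>The tangent vector \<open>z\<^sub>u = f' l + g' \<xi>\<^sub>1\<close> with the sign of \<open>\<xi>\<^sub>1\<close> reversed: as \<open>l\<close> and \<open>\<xi>\<^sub>1\<close> are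
  null, \<open>\<langle>N, z\<^sub>u\<rangle>\<close> consists of two mixed terms, which cancel.\<close>

definition N :: "real \<Rightarrow> real \<Rightarrow> real^4" where
  "N u v = f1 u *\<^sub>R l v - g1 u *\<^sub>R xi1 e"

lemma z_eq: "z u v = f u *\<^sub>R l v + g u *\<^sub>R xi1 e"
  by (simp add: meridian_surface_def curve_c_def l_def frame_vec_def)

text \<open>The last formula differentiates \<open>f' g' = \<epsilon>/2\<close>; it is what makes the \<open>u\<close>-lines have
  \<open>z\<^sub>u\<^sub>u\<close> purely normal.\<close>

lemma DERIV_fg:
  assumes "u \<in> I"
  shows "(f has_field_derivative f1 u) (at u)" "(f1 has_field_derivative f2 u) (at u)"
    "(f2 has_field_derivative deriv f2 u) (at u)"
    "(g has_field_derivative g1 u) (at u)" "(g1 has_field_derivative - f2 u * g1 u / f1 u) (at u)"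
proof -
  show "(f has_field_derivative f1 u) (at u)" "(f1 has_field_derivative f2 u) (at u)"
    "(f2 has_field_derivative deriv f2 u) (at u)"
    "(g has_field_derivative g1 u) (at u)"
    using smooth_on_open_DERIV[OF smooth(1) assms] smooth_on_open_DERIV[OF smooth(2) assms] by auto
  then have "((\<lambda>u. \<epsilon> / (2 * f1 u)) has_field_derivative - f2 u * g1 u / f1 u) (at u)"
    using f1_nz[OF assms]
    by (auto intro!: derivative_eq_intros simp: g1_eq[OF assms] field_simps)
  then show "(g1 has_field_derivative - f2 u * g1 u / f1 u) (at u)"
    by (rule has_field_derivative_transform_within_open[OF _ I(1) assms]) (simp add: g1_eq)
qed

lemma pd_z:
  assumes "u \<in> I" "v \<in> J"
  shows "pd 1 z u v = f1 u *\<^sub>R l v + g1 u *\<^sub>R xi1 e" "pd 2 z u v = f u *\<^sub>R l1 v"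
proof -
  show "pd 1 z u v = f1 u *\<^sub>R l v + g1 u *\<^sub>R xi1 e"
    by (rule pd_1_eqI[where w = z and v = v, OF I(1) assms(1) z_eq])
       (auto intro!: derivative_eq_intros DERIV_fg assms)
  show "pd 2 z u v = f u *\<^sub>R l1 v"
    by (rule pd_2_eqI[where w = z and u = u, OF J(1) assms(2) z_eq])
       (auto intro!: derivative_eq_intros deriv_l assms)
qed

lemma pd_pd_z:
  assumes u: "u \<in> I" and v: "v \<in> J"
  shows "pd 1 (pd 1 z) u v = (f2 u / f1 u) *\<^sub>R N u v"
    and "pd 2 (pd 2 z) u v = f u *\<^sub>R
      (W v *\<^sub>R xi1 e + (W1 v / (2 * W v)) *\<^sub>R l1 v - (K v / W v) *\<^sub>R nu v)"
proof -
  have f: "f1 u \<noteq> 0" "f u \<noteq> 0"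
    using f1_nz[OF u] f_pos[OF u] by auto
  have "pd 1 (pd 1 z) u v = f2 u *\<^sub>R l v + (- f2 u * g1 u / f1 u) *\<^sub>R xi1 e"
    by (rule pd_1_eqI[where w = "pd 1 z" and v = v, OF I(1) u pd_z(1)[OF _ v]])
       (auto intro!: derivative_eq_intros DERIV_fg u)
  then show "pd 1 (pd 1 z) u v = (f2 u / f1 u) *\<^sub>R N u v"
    using f by (simp add: N_def algebra_simps)
  show "pd 2 (pd 2 z) u v = f u *\<^sub>R
      (W v *\<^sub>R xi1 e + (W1 v / (2 * W v)) *\<^sub>R l1 v - (K v / W v) *\<^sub>R nu v)"
    by (rule pd_2_eqI[where w = "pd 2 z" and u = u, OF J(1) v pd_z(2)[OF u]])
       (auto intro!: derivative_eq_intros deriv_l1 v)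
qed

lemma first_ff:
  assumes u: "u \<in> I" and v: "v \<in> J"
  shows "pinner (pd 1 z u v) (pd 1 z u v) = - \<epsilon>" "pinner (pd 1 z u v) (pd 2 z u v) = 0"
    "pinner (pd 2 z u v) (pd 1 z u v) = 0" "pinner (pd 2 z u v) (pd 2 z u v) = (f u)\<^sup>2 * W v"
  using f1_nz[OF u] by (simp_all add: pd_z[OF u v] g1_eq[OF u] power2_eq_square)

lemma pinner_normal_frame:
  assumes u: "u \<in> I" and v: "v \<in> J"
  shows "pinner (N u v) (N u v) = \<epsilon>" "pinner (N u v) (nu v) = 0" "pinner (nu v) (N u v) = 0"
    "pinner (N u v) (pd 1 z u v) = 0" "pinner (N u v) (pd 2 z u v) = 0"
    "pinner (nu v) (pd 1 z u v) = 0" "pinner (nu v) (pd 2 z u v) = 0"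
  using f1_nz[OF u] by (simp_all add: N_def pd_z[OF u v] g1_eq[OF u])

lemma normal_part_frame:
  assumes u: "u \<in> I" and v: "v \<in> J"
    and "w = (p *\<^sub>R N u v + q *\<^sub>R nu v) + a *\<^sub>R pd 1 z u v + b *\<^sub>R pd 2 z u v"
  shows "normal_part z u v w = p *\<^sub>R N u v + q *\<^sub>R nu v"
  using f_pos[OF u] W_nz[OF v]
  by (intro normal_part_eqI[OF _ _ _ _ _ assms(3)])
     (auto simp: first_ff[OF u v] pinner_normal_frame[OF u v])

lemma induced_metric_eq:
  assumes u: "u \<in> I" and v: "v \<in> J"
  shows "induced_metric z u v $ i $ j =
    (if i \<noteq> j then 0 else if i = 1 then - \<epsilon> else (f u)\<^sup>2 * W v)"
  using exhaust_2[of i] exhaust_2[of j] by (auto simp: induced_metric_def first_ff[OF u v])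

lemma inverse_metric_eq:
  assumes u: "u \<in> I" and v: "v \<in> J"
  shows "matrix_inv (induced_metric z u v) $ i $ j =
    (if i \<noteq> j then 0 else if i = 1 then - \<epsilon> else 1 / ((f u)\<^sup>2 * W v))"
proof -
  have "matrix_inv (induced_metric z u v) =
      (\<chi> i j. if i = j then 1 / induced_metric z u v $ i $ i else 0)"
    using f_pos[OF u] W_nz[OF v]
    by (intro matrix_inv_diagonal_2) (auto simp: induced_metric_eq[OF u v])
  then show ?thesis
    using exhaust_2[of i] exhaust_2[of j] eps by (auto simp: induced_metric_eq[OF u v])
qed

lemma second_ff_eq:
  assumes u: "u \<in> I" and v: "v \<in> J"
  shows "second_ff z 1 1 u v = (f2 u / f1 u) *\<^sub>R N u v"
    and "second_ff z 2 2 u v = (- \<epsilon> * f u * f1 u * W v) *\<^sub>R N u v - (f u * K v / W v) *\<^sub>R nu v"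
proof -
  show "second_ff z 1 1 u v = (f2 u / f1 u) *\<^sub>R N u v"
    using normal_part_frame[OF u v, of "pd 1 (pd 1 z) u v" "f2 u / f1 u" 0 0 0]
    by (simp add: second_ff_def pd_pd_z[OF u v])
  \<comment> \<open>The null vector \<open>\<xi>\<^sub>1\<close> is proportional to \<open>z\<^sub>u - N\<close>, so it contributes to the normal part.\<close>
  have "c *\<^sub>R xi1 e = (c * (\<epsilon> * f1 u)) *\<^sub>R (pd 1 z u v - N u v)" for c
    using f1_nz[OF u] by (simp add: pd_z[OF u v] N_def g1_eq[OF u] algebra_simps flip: scaleR_left.add)
  from this[of "f u * W v"] have "pd 2 (pd 2 z) u v =
     ((- \<epsilon> * f u * f1 u * W v) *\<^sub>R N u v + (- (f u * K v / W v)) *\<^sub>R nu v)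
      + (\<epsilon> * f u * f1 u * W v) *\<^sub>R pd 1 z u v + (W1 v / (2 * W v)) *\<^sub>R pd 2 z u v"
    unfolding pd_pd_z[OF u v]
    by (simp add: pd_z(2)[OF u v] algebra_simps)
  from normal_part_frame[OF u v this]
  show "second_ff z 2 2 u v = (- \<epsilon> * f u * f1 u * W v) *\<^sub>R N u v - (f u * K v / W v) *\<^sub>R nu v"
    by (simp add: second_ff_def)
qed

section \<open>The mean curvature vector and its normal derivative\<close>

definition P :: "real \<Rightarrow> real" where
  "P u = - \<epsilon> / 2 * (f2 u / f1 u + f1 u / f u)"

definition Q :: "real \<Rightarrow> real \<Rightarrow> real" where
  "Q u v = - K v / (2 * f u * (W v)\<^sup>2)"

lemma mean_curvature_eq:
  assumes u: "u \<in> I" and v: "v \<in> J"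
  shows "mean_curvature z u v = P u *\<^sub>R N u v + Q u v *\<^sub>R nu v"
proof -
  have nz: "f u \<noteq> 0" "W v \<noteq> 0"
    using f_pos[OF u] W_nz[OF v] by auto
  have "mean_curvature z u v =
     (1/2) *\<^sub>R (- \<epsilon> *\<^sub>R second_ff z 1 1 u v + (1 / ((f u)\<^sup>2 * W v)) *\<^sub>R second_ff z 2 2 u v)"
    by (simp add: mean_curvature_def sum_2 inverse_metric_eq[OF u v])
  also have "\<dots> = (1/2 * (- \<epsilon> * (f2 u / f1 u) + 1 / ((f u)\<^sup>2 * W v) * (- \<epsilon> * f u * f1 u * W v))) *\<^sub>R N u v
      + (1/2 * (1 / ((f u)\<^sup>2 * W v)) * (- (f u * K v / W v))) *\<^sub>R nu v"
    unfolding second_ff_eq[OF u v]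
    by (simp add: algebra_simps)
  also have "1/2 * (- \<epsilon> * (f2 u / f1 u) + 1 / ((f u)\<^sup>2 * W v) * (- \<epsilon> * f u * f1 u * W v)) = P u"
    using nz f1_nz[OF u] by (simp add: P_def field_simps power2_eq_square)
  also have "1/2 * (1 / ((f u)\<^sup>2 * W v)) * (- (f u * K v / W v)) = Q u v"
    using nz by (simp add: Q_def field_simps power2_eq_square)
  finally show ?thesis .
qed

lemma DERIV_P: "u \<in> I \<Longrightarrow> (P has_field_derivative deriv P u) (at u)"
proof -
  assume u: "u \<in> I"
  have "(P has_field_derivative - \<epsilon> / 2 *
      ((deriv f2 u * f1 u - f2 u * f2 u) / (f1 u * f1 u)
       + (f2 u * f u - f1 u * f1 u) / (f u * f u))) (at u)"
    unfolding P_def[abs_def] using f_pos[OF u] f1_nz[OF u]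
    by (intro DERIV_cmult DERIV_add DERIV_divide DERIV_fg u) auto
  then show ?thesis
    using DERIV_imp_deriv by fastforce
qed

text \<open>Both partial derivatives of \<open>N\<close> are tangent, so \<open>N\<close> is a parallel normal field on every
  meridian surface.\<close>

lemma deriv_N_u:
  assumes u: "u \<in> I" and v: "v \<in> J"
  shows "((\<lambda>u. N u v) has_vector_derivative (f2 u / f1 u) *\<^sub>R pd 1 z u v) (at u)"
proof -
  have "((\<lambda>u. N u v) has_vector_derivative f2 u *\<^sub>R l v - (- f2 u * g1 u / f1 u) *\<^sub>R xi1 e) (at u)"
    unfolding N_def by (auto intro!: derivative_eq_intros DERIV_fg u)
  then show ?thesis
    using f1_nz[OF u] by (simp add: pd_z[OF u v] algebra_simps)
qed

lemma deriv_N_v: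
  assumes u: "u \<in> I" and v: "v \<in> J"
  shows "(N u has_vector_derivative (f1 u / f u) *\<^sub>R pd 2 z u v) (at v)"
proof -
  have "(N u has_vector_derivative f1 u *\<^sub>R l1 v) (at v)"
    unfolding N_def[abs_def] by (auto intro!: derivative_eq_intros deriv_l v)
  then show ?thesis
    using f_pos[OF u] by (simp add: pd_z[OF u v])
qed

text \<open>The coefficient of \<open>\<nu>\<close> is \<open>\<partial>Q/\<partial>u\<close>, because \<open>\<nu>\<close> does not depend on \<open>u\<close>; along a \<open>u\<close>-line \<open>Q\<close>
  is proportional to \<open>1/f\<close>.\<close>

lemma pd_1_mean_curvature:
  assumes u: "u \<in> I" and v: "v \<in> J"
  shows "pd 1 (mean_curvature z) u v =
     (deriv P u *\<^sub>R N u v + (- f1 u / f u * Q u v) *\<^sub>R nu v)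
       + (P u * (f2 u / f1 u)) *\<^sub>R pd 1 z u v + 0 *\<^sub>R pd 2 z u v"
proof -
  have "((\<lambda>u. Q u v) has_field_derivative - f1 u / f u * Q u v) (at u)"
    unfolding Q_def using f_pos[OF u] W_nz[OF v]
    by (auto intro!: derivative_eq_intros DERIV_fg u simp: field_simps power2_eq_square)
  then have "((\<lambda>u. P u *\<^sub>R N u v + Q u v *\<^sub>R nu v) has_vector_derivative
     (P u *\<^sub>R (f2 u / f1 u) *\<^sub>R pd 1 z u v + deriv P u *\<^sub>R N u v) + (- f1 u / f u * Q u v) *\<^sub>R nu v) (at u)"
    by (auto intro!: derivative_eq_intros DERIV_P deriv_N_u u v)
  then have "pd 1 (mean_curvature z) u v =
     (P u *\<^sub>R (f2 u / f1 u) *\<^sub>R pd 1 z u v + deriv P u *\<^sub>R N u v) + (- f1 u / f u * Q u v) *\<^sub>R nu v"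
    using mean_curvature_eq[OF _ v] by (intro pd_1_eqI[OF I(1) u]) auto
  then show ?thesis
    by simp
qed

lemma normal_connection_components:
  "normal_connection z X w u v = normal_part z u v (X $ 1 *\<^sub>R pd 1 w u v + X $ 2 *\<^sub>R pd 2 w u v)"
  by (simp add: normal_connection_def sum_2)

text \<open>The \<open>u\<close>-direction alone forces \<open>P' = 0\<close> and \<open>(f'/f) Q = 0\<close>. Conversely \<open>H = c N\<close>, and \<open>N\<close> is
  parallel and nowhere zero.\<close>

lemma nonzero_parallel_iff:
  "(\<forall>u\<in>I. \<forall>v\<in>J. mean_curvature z u v \<noteq> 0) \<and> parallel_on I J z (mean_curvature z) \<longleftrightarrow>
   (\<forall>v\<in>J. K v = 0) \<and> (\<exists>c. c \<noteq> 0 \<and> (\<forall>u\<in>I. P u = c))"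
  (is "?nonzero \<and> ?parallel \<longleftrightarrow> ?flat_c \<and> ?const")
proof
  assume H: "?nonzero \<and> ?parallel"
  obtain u0 v0 where u0: "u0 \<in> I" and v0: "v0 \<in> J"
    using I(3) J(3) by auto
  have comps: "deriv P u = 0 \<and> K v = 0" if u: "u \<in> I" and v: "v \<in> J" for u v
  proof -
    let ?X = "(\<chi> i. if i = 1 then 1 else 0) :: real^2"
    have "normal_connection z ?X (mean_curvature z) u v = 0"
      using H u v by (auto simp: parallel_on_def)
    then have 0: "deriv P u *\<^sub>R N u v + (- f1 u / f u * Q u v) *\<^sub>R nu v = 0" (is "?D = 0")
      using normal_part_frame[OF u v pd_1_mean_curvature[OF u v]]
      by (simp add: normal_connection_components)
    have "pinner ?D (N u v) = 0" "pinner ?D (nu v) = 0"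
      unfolding 0 by simp_all
    then show ?thesis
      using f1_nz[OF u] f_pos[OF u] W_nz[OF v]
      by (simp add: pinner_normal_frame[OF u v] Q_def)
  qed
  then have K: ?flat_c
    using u0 by blast
  have P: "P u = P u0" if "u \<in> I" for u
  proof (rule vector_derivative_zero_on_interval[OF I(1,2) _ that u0])
    show "(P has_vector_derivative 0) (at u)" if "u \<in> I" for u
      using has_vector_derivative_real[OF DERIV_P[OF that]] comps[OF that v0] by simp
  qed
  have "mean_curvature z u0 v0 \<noteq> 0"
    using H u0 v0 by blast
  then have "P u0 \<noteq> 0"
    using K v0 by (auto simp: mean_curvature_eq[OF u0 v0] Q_def)
  with K P show "?flat_c \<and> ?const"
    by blast
next
  assume "?flat_c \<and> ?const"
  then obtain c where K: "\<And>v. v \<in> J \<Longrightarrow> K v = 0" and c: "c \<noteq> 0" "\<And>u. u \<in> I \<Longrightarrow> P u = c"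
    by blast
  have H: "mean_curvature z u v = c *\<^sub>R N u v" if "u \<in> I" "v \<in> J" for u v
    using that by (simp add: mean_curvature_eq Q_def K c)
  have "N u v \<noteq> 0" if "u \<in> I" "v \<in> J" for u v
    using pinner_normal_frame(1)[OF that] by auto
  then have ?nonzero
    using H c by simp
  moreover have ?parallel
    unfolding parallel_on_def
  proof (intro ballI allI)
    fix u v X assume u: "u \<in> I" and v: "v \<in> J"
    have "pd 1 (mean_curvature z) u v = c *\<^sub>R (f2 u / f1 u) *\<^sub>R pd 1 z u v"
      by (rule pd_1_eqI[where w = "mean_curvature z" and v = v, OF I(1) u H[OF _ v]])
         (auto intro!: derivative_eq_intros deriv_N_u u v)
    moreover have "pd 2 (mean_curvature z) u v = c *\<^sub>R (f1 u / f u) *\<^sub>R pd 2 z u v"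
      by (rule pd_2_eqI[where w = "mean_curvature z" and u = u, OF J(1) v H[OF u]])
         (auto intro!: derivative_eq_intros deriv_N_v u v)
    ultimately show "normal_connection z X (mean_curvature z) u v = 0"
      using normal_part_frame[OF u v, of _ 0 0 "X $ 1 * (c * (f2 u / f1 u))" "X $ 2 * (c * (f1 u / f u))"]
      by (simp add: normal_connection_components)
  qed
  ultimately show "?nonzero \<and> ?parallel" ..
qed

lemma kappa_zero_iff: "v \<in> J \<Longrightarrow> kappa \<epsilon> \<phi> v = 0 \<longleftrightarrow> K v = 0"
  using causal[of v] by (auto simp: kappa_def K_def)

text \<open>Clearing denominators, \<open>P = -\<epsilon>a/2\<close> becomes \<open>(2 f f' - a f\<^sup>2)' = 0\<close>; the integration constant
  is \<open>b\<close>.\<close>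

lemma P_const_iff_meridian:
  "(\<forall>u\<in>I. P u = - \<epsilon> * a / 2) \<longleftrightarrow> (\<exists>b. \<forall>u\<in>I. f1 u = (a * (f u)\<^sup>2 + b) / (2 * f u))"
proof -
  let ?h = "\<lambda>u. 2 * f u * f1 u - a * (f u)\<^sup>2"
  have h: "(?h has_vector_derivative 2 * ((f1 u)\<^sup>2 + f u * f2 u - a * f u * f1 u)) (at u)"
    if u: "u \<in> I" for u
    by (rule has_vector_derivative_real)
       (auto intro!: derivative_eq_intros DERIV_fg u simp: algebra_simps power2_eq_square)
  have P: "P u = - \<epsilon> * a / 2 \<longleftrightarrow> (f1 u)\<^sup>2 + f u * f2 u - a * f u * f1 u = 0" if u: "u \<in> I" for u
  proof -
    have "P u = - \<epsilon> * a / 2 \<longleftrightarrow> f2 u / f1 u + f1 u / f u = a"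
      using eps by (auto simp: P_def)
    also have "\<dots> \<longleftrightarrow> (f1 u)\<^sup>2 + f u * f2 u - a * f u * f1 u = 0"
      using f_pos[OF u] f1_nz[OF u] by (simp add: field_simps power2_eq_square)
    finally show ?thesis .
  qed
  have ode: "f1 u = (a * (f u)\<^sup>2 + b) / (2 * f u) \<longleftrightarrow> ?h u = b" if u: "u \<in> I" for u b
    using f_pos[OF u] by (simp add: field_simps)
  have "(\<forall>u\<in>I. P u = - \<epsilon> * a / 2) \<longleftrightarrow> (\<exists>b. \<forall>u\<in>I. ?h u = b)"
  proof
    assume "\<forall>u\<in>I. P u = - \<epsilon> * a / 2"
    then have "(?h has_vector_derivative 0) (at u)" if "u \<in> I" for u
      using P[OF that] h[OF that] that by simp
    from vector_derivative_zero_on_interval[OF I(1,2) this]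
    show "\<exists>b. \<forall>u\<in>I. ?h u = b"
      by blast
  next
    assume "\<exists>b. \<forall>u\<in>I. ?h u = b"
    then obtain b where b: "\<And>u. u \<in> I \<Longrightarrow> b = ?h u"
      by auto
    show "\<forall>u\<in>I. P u = - \<epsilon> * a / 2"
    proof
      fix u assume u: "u \<in> I"
      have "(?h has_vector_derivative 0) (at u)"
        by (rule has_vector_derivative_transform_within_open[OF has_vector_derivative_const I(1) u b])
      from vector_derivative_unique_at[OF h[OF u] this]
      show "P u = - \<epsilon> * a / 2"
        unfolding P[OF u] by simp
    qed
  qed
  then show ?thesis
    using ode by auto
qed

section \<open>Gauss curvature\<close>

lemma pd_metric:
  assumes u: "u \<in> I" and v: "v \<in> J"
  shows "pd 1 (\<lambda>u v. induced_metric z u v $ i $ j) u v =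
      (if i = 2 \<and> j = 2 then 2 * f u * f1 u * W v else 0)"
    and "pd 2 (\<lambda>u v. induced_metric z u v $ i $ j) u v =
      (if i = 2 \<and> j = 2 then (f u)\<^sup>2 * W1 v else 0)"
proof -
  show "pd 1 (\<lambda>u v. induced_metric z u v $ i $ j) u v =
      (if i = 2 \<and> j = 2 then 2 * f u * f1 u * W v else 0)"
    using exhaust_2[of i] exhaust_2[of j]
    by (intro pd_1_eqI[where w = "\<lambda>u v. induced_metric z u v $ i $ j" and v = v, OF I(1) u induced_metric_eq[OF _ v]] has_vector_derivative_real)
       (auto intro!: derivative_eq_intros DERIV_fg u)
  show "pd 2 (\<lambda>u v. induced_metric z u v $ i $ j) u v =
      (if i = 2 \<and> j = 2 then (f u)\<^sup>2 * W1 v else 0)"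
    using exhaust_2[of i] exhaust_2[of j]
    by (intro pd_2_eqI[where w = "\<lambda>u v. induced_metric z u v $ i $ j" and u = u, OF J(1) v induced_metric_eq[OF u]] has_vector_derivative_real)
       (auto intro!: derivative_eq_intros DERIV_W v)
qed

lemma christoffel_eq:
  assumes u: "u \<in> I" and v: "v \<in> J"
  shows "christoffel z 1 1 1 u v = 0" "christoffel z 1 1 2 u v = 0" "christoffel z 1 2 1 u v = 0"
    "christoffel z 1 2 2 u v = \<epsilon> * f u * f1 u * W v"
    "christoffel z 2 1 2 u v = f1 u / f u"
  using f_pos[OF u] W_nz[OF v]
  by (simp_all add: christoffel_def sum_2 inverse_metric_eq[OF u v] pd_metric[OF u v]
        field_simps power2_eq_square)

text \<open>The metric is \<open>-\<epsilon> du\<^sup>2 + f(u)\<^sup>2 W(v) dv\<^sup>2\<close>. The factor \<open>W(v)\<close> amounts to a reparametrization of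
  \<open>v\<close>, so the value is that of a surface of revolution with profile \<open>f\<close>, up to sign.\<close>

lemma gauss_curvature_eq:
  assumes u: "u \<in> I" and v: "v \<in> J"
  shows "gauss_curvature z u v = \<epsilon> * f2 u / f u"
proof -
  have nz: "f u \<noteq> 0" "W v \<noteq> 0"
    using f_pos[OF u] W_nz[OF v] by auto
  have 1: "pd 1 (christoffel z 1 2 2) u v = \<epsilon> * W v * ((f1 u)\<^sup>2 + f u * f2 u)"
    by (intro pd_1_eqI[where w = "christoffel z 1 2 2" and v = v, OF I(1) u christoffel_eq(4)[OF _ v]]
          has_vector_derivative_real)
       (auto intro!: derivative_eq_intros DERIV_fg u simp: algebra_simps power2_eq_square)
  have 2: "pd 2 (christoffel z 1 1 2) u v = 0"
    by (rule pd_2_eqI[where w = "christoffel z 1 1 2" and u = u, OF J(1) v christoffel_eq(2)[OF u]]) auto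
  have "riemann z 1 2 1 2 u v = \<epsilon> * W v * f u * f2 u"
    using nz by (simp add: riemann_def sum_2 1 2 christoffel_eq[OF u v] algebra_simps power2_eq_square)
  then show ?thesis
    using nz eps by (auto simp: gauss_curvature_def sum_2 det_2 induced_metric_eq[OF u v] power2_eq_square)
qed

section \<open>Constant mean curvature, non-flatness and the hyperplane\<close>

text \<open>In a flat surface \<open>f'' = 0\<close>, and then \<open>P = c\<close> reads \<open>f' = -2\<epsilon>c f\<close>. Differentiating this
  gives \<open>f'' = -2\<epsilon>c f'\<close>, which is not zero.\<close>

lemma P_const_not_flat:
  assumes c: "c \<noteq> 0" "\<And>u. u \<in> I \<Longrightarrow> P u = c"
  shows "\<not> flat_on I J z"
proof
  assume flat: "flat_on I J z"
  obtain u v where u: "u \<in> I" and v: "v \<in> J"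
    using I(3) J(3) by auto
  have f2: "f2 u = 0" if "u \<in> I" for u
    using flat that v f_pos[OF that] by (auto simp: flat_on_def gauss_curvature_eq)
  have f1: "- 2 * \<epsilon> * c * f u = f1 u" if u: "u \<in> I" for u
    using c(2)[OF u] f_pos[OF u] eps by (auto simp: P_def f2[OF u] field_simps)
  have "((\<lambda>u. - 2 * \<epsilon> * c * f u) has_field_derivative - 2 * \<epsilon> * c * f1 u) (at u)"
    by (auto intro!: derivative_eq_intros DERIV_fg u)
  then have "(f1 has_field_derivative - 2 * \<epsilon> * c * f1 u) (at u)"
    by (rule has_field_derivative_transform_within_open[OF _ I(1) u f1])
  then have "- 2 * \<epsilon> * c * f1 u = f2 u"
    by (rule DERIV_imp_deriv[symmetric])
  then show False
    using f2[OF u] c(1) f1_nz[OF u] by simp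
qed

lemma K_zero_CMC:
  assumes K: "\<And>v. v \<in> J \<Longrightarrow> K v = 0" and c: "c \<noteq> 0" "\<And>u. u \<in> I \<Longrightarrow> P u = c"
  shows "CMC_on I J z"
proof -
  have "pinner (mean_curvature z u v) (mean_curvature z u v) = c\<^sup>2 * \<epsilon>" if "u \<in> I" "v \<in> J" for u v
    using that by (simp add: mean_curvature_eq Q_def K c pinner_normal_frame power2_eq_square)
  then show ?thesis
    unfolding CMC_on_def using c by (intro exI[of _ "c\<^sup>2 * \<epsilon>"]) auto
qed

text \<open>For \<open>K = 0\<close> the vector \<open>\<nu>\<close> satisfies \<open>\<nu>' = (W'/2W) \<nu>\<close>, so \<open>\<nu> / \<surd>(\<epsilon>W)\<close> is constant. It is
  orthogonal to \<open>l(v)\<close> for every \<open>v\<close> and to \<open>\<xi>\<^sub>1\<close>, hence to the surface, which therefore lies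
  even in a hyperplane through the origin.\<close>

lemma K_zero_in_hyperplane:
  assumes K: "\<And>v. v \<in> J \<Longrightarrow> K v = 0"
  shows "in_hyperplane_on I J z"
proof -
  obtain v0 where v0: "v0 \<in> J"
    using J(3) by auto
  define r where "r v = sqrt (\<epsilon> * W v)" for v
  define m where "m v = (1 / r v) *\<^sub>R nu v" for v
  have pos: "\<epsilon> * W v > 0" if "v \<in> J" for v
    using causal[OF that] by (simp add: W_def)
  then have r: "r v > 0" "r v * r v = \<epsilon> * W v" if "v \<in> J" for v
    using that by (auto simp: r_def less_imp_le)
  have "(m has_vector_derivative 0) (at v)" if v: "v \<in> J" for v
  proof -
    have "(r has_field_derivative \<epsilon> * W1 v / (2 * r v)) (at v)"
      unfolding r_def[abs_def] using pos[OF v]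
      by (auto intro!: derivative_eq_intros DERIV_W v simp: field_simps)
    also have "\<epsilon> * W1 v / (2 * r v) = r v * (W1 v / (2 * W v))"
      using r[OF v] W_nz[OF v] by (simp add: field_simps)
    finally have "((\<lambda>v. 1 / r v) has_field_derivative - (1 / r v) * (W1 v / (2 * W v))) (at v)"
      using r(1)[OF v] by (auto intro!: derivative_eq_intros simp: field_simps)
    from has_vector_derivative_scaleR[OF this deriv_nu[OF v]]
    show ?thesis
      unfolding m_def by (simp add: K[OF v])
  qed
  from vector_derivative_zero_on_interval[OF J(1,2) this]
  have m: "m v = m v0" if "v \<in> J" for v
    using that v0 by blast
  show ?thesis
  proof (rule in_hyperplane_onI)
    show "m v0 \<noteq> 0"
      using nu_nz[OF v0] r(1)[OF v0] by (auto simp: m_def)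
    fix u v assume "u \<in> I" "v \<in> J"
    have "pinner (z u v) (m v) = 0"
      by (simp add: m_def z_eq)
    then show "pinner (z u v) (m v0) = 0"
      using m[OF \<open>v \<in> J\<close>] by simp
  qed
qed

end


theorem theorem4:
  fixes e :: "4 \<Rightarrow> real^4"
    and I J :: "real set"
    and f g \<phi> :: "real \<Rightarrow> real"
    and \<epsilon> :: real
  defines "z \<equiv> meridian_surface e \<phi> f g"
  assumes basis: "pseudo_orthonormal e"
    and I: "open I" "is_interval I" "I \<noteq> {}"
    and J: "open J" "is_interval J" "J \<noteq> {}"
    and smooth: "smooth_on_open I f" "smooth_on_open I g" "smooth_on_open J \<phi>"
    and f_pos: "\<forall>u\<in>I. f u > 0"
    and lorentz:
      "(\<epsilon> = 1 \<and> (\<forall>v\<in>J. (deriv \<phi> v)\<^sup>2 - (\<phi> v)\<^sup>2 > 0) \<and> (\<forall>u\<in>I. deriv f u * deriv g u > 0)) \<or>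
       (\<epsilon> = -1 \<and> (\<forall>v\<in>J. (deriv \<phi> v)\<^sup>2 - (\<phi> v)\<^sup>2 < 0) \<and> (\<forall>u\<in>I. deriv f u * deriv g u < 0))"
    and normalized: "\<forall>u\<in>I. 2 * \<epsilon> * deriv f u * deriv g u = 1"
  shows
    "(((\<forall>u\<in>I. \<forall>v\<in>J. mean_curvature z u v \<noteq> 0) \<and> parallel_on I J z (mean_curvature z))
       \<longleftrightarrow>
       ((\<forall>v\<in>J. kappa \<epsilon> \<phi> v = 0) \<and>
        (\<exists>a b. a \<noteq> 0 \<and> (\<forall>u\<in>I. deriv f u = (a * (f u)\<^sup>2 + b) / (2 * f u)
                              \<and> deriv g u = \<epsilon> / (2 * deriv f u)))))
     \<and>
     (((\<forall>u\<in>I. \<forall>v\<in>J. mean_curvature z u v \<noteq> 0) \<and> parallel_on I J z (mean_curvature z))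
       \<longrightarrow> \<not> flat_on I J z \<and> CMC_on I J z \<and> in_hyperplane_on I J z)"
proof -
  interpret meridian e I J f g \<phi> \<epsilon>
    using assms lorentz by unfold_locales auto
  let ?parallel = "(\<forall>u\<in>I. \<forall>v\<in>J. mean_curvature z u v \<noteq> 0) \<and> parallel_on I J z (mean_curvature z)"
  have parallel: "?parallel \<longleftrightarrow> (\<forall>v\<in>J. K v = 0) \<and> (\<exists>c. c \<noteq> 0 \<and> (\<forall>u\<in>I. P u = c))"
    unfolding z_def by (rule nonzero_parallel_iff)
  have "(\<exists>c. c \<noteq> 0 \<and> (\<forall>u\<in>I. P u = c)) \<longleftrightarrow> (\<exists>a. a \<noteq> 0 \<and> (\<forall>u\<in>I. P u = - \<epsilon> * a / 2))"
  proof
    assume "\<exists>c. c \<noteq> 0 \<and> (\<forall>u\<in>I. P u = c)"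
    then obtain c where c: "c \<noteq> 0" "\<forall>u\<in>I. P u = c"
      by blast
    \<comment> \<open>Since \<open>\<epsilon>\<^sup>2 = 1\<close>, the constant \<open>a = -2\<epsilon>c\<close> inverts \<open>c = -\<epsilon>a/2\<close>.\<close>
    have "- \<epsilon> * (- 2 * \<epsilon> * c) / 2 = c"
      using eps by auto
    with c show "\<exists>a. a \<noteq> 0 \<and> (\<forall>u\<in>I. P u = - \<epsilon> * a / 2)"
      by (intro exI[of _ "- 2 * \<epsilon> * c"]) auto
  next
    assume "\<exists>a. a \<noteq> 0 \<and> (\<forall>u\<in>I. P u = - \<epsilon> * a / 2)"
    then obtain a where "a \<noteq> 0" "\<forall>u\<in>I. P u = - \<epsilon> * a / 2"
      by blast
    then show "\<exists>c. c \<noteq> 0 \<and> (\<forall>u\<in>I. P u = c)"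
      by (intro exI[of _ "- \<epsilon> * a / 2"]) auto
  qed
  also have "\<dots> \<longleftrightarrow> (\<exists>a b. a \<noteq> 0 \<and> (\<forall>u\<in>I. f1 u = (a * (f u)\<^sup>2 + b) / (2 * f u)))"
    unfolding P_const_iff_meridian by blast
  also have "\<dots> \<longleftrightarrow> (\<exists>a b. a \<noteq> 0 \<and> (\<forall>u\<in>I. f1 u = (a * (f u)\<^sup>2 + b) / (2 * f u)
      \<and> g1 u = \<epsilon> / (2 * f1 u)))"
    using g1_eq by blast
  finally have ode: "(\<exists>c. c \<noteq> 0 \<and> (\<forall>u\<in>I. P u = c)) \<longleftrightarrow> \<dots>" .
  have "?parallel \<longleftrightarrow> (\<forall>v\<in>J. kappa \<epsilon> \<phi> v = 0) \<and>
      (\<exists>a b. a \<noteq> 0 \<and> (\<forall>u\<in>I. f1 u = (a * (f u)\<^sup>2 + b) / (2 * f u) \<and> g1 u = \<epsilon> / (2 * f1 u)))"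
    unfolding parallel ode using kappa_zero_iff by blast
  moreover have "?parallel \<longrightarrow> \<not> flat_on I J z \<and> CMC_on I J z \<and> in_hyperplane_on I J z"
  proof
    assume ?parallel
    then obtain c where K: "\<And>v. v \<in> J \<Longrightarrow> K v = 0" and c: "c \<noteq> 0" "\<And>u. u \<in> I \<Longrightarrow> P u = c"
      unfolding parallel by blast
    show "\<not> flat_on I J z \<and> CMC_on I J z \<and> in_hyperplane_on I J z"
      unfolding z_def
      using P_const_not_flat[OF c] K_zero_CMC[OF K c] K_zero_in_hyperplane[OF K] by blast
  qed
  ultimately show ?thesis ..
qed

end
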